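(* Let $\Omega\subseteq\mathbb R^n$ be a fluid domain and let $\rho:\Omega_h(\mathbf r)\subset\Omega\to\mathbb R$ be the fluid density. The filtering of $\rho$ by the convolution filter $w_h\in C_c^\infty(\Omega)$ yields the local density approximation $\langle\rho_h\rangle:\Omega_h(\mathbf r)\subset\Omega\to\mathbb R$ (the filtered density). Then for all $\mathbf r\in\Omega_h(\mathbf r)$, in the continuum limit, $$\lim_{h\to0}\langle\rho_h(\mathbf r)\rangle=\rho(\mathbf r)\iff\lim_{h\to0}\hat\rho_h(\mathbf r)=0,$$ uniformly; that is, the filtered density converges uniformly to the density or, equivalently, the local density fluctuation $\hat\rho_h$ converges uniformly to $0$.
   Context: A fluid domain is an open set $\Omega\subseteq\mathbb R^n$, bounded by a smooth surface $\partial\Omega$, on which the mass density satisfies $\rho>0$; fluid variables such as $\rho$ are assumed to be smooth and continuous. For a filter length $h>0$ and a point $\mathbf r\in\Omega$, the test space centered at $\mathbf r$ is the support of the filter, $\Omega_h(\mathbf r)=\{\mathbf r'\in\mathbb R^n:\|\mathbf r-\mathbf r'\|\le h\}$. Either $\Omega$ is unbounded or the support of the filter does not meet $\partial\Omega$. The convolution filter enters as $\mathbf r'\mapsto w_h(\mathbf r-\mathbf r')$, is smooth with compact support $\Omega_h(\mathbf r)$, and satisfies $w_h\ge0$ and $\int_{\Omega_h(\mathbf r)}w_h(\mathbf r-\mathbf r')\,d^n\mathbf r'=1$. The filtered density is $$\langle\rho_h(\mathbf r)\rangle=\int_{\Omega_h(\mathbf r)}\rho(\mathbf r')\,w_h(\mathbf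 r-\mathbf r')\,d^n\mathbf r',$$ and the local density fluctuation is $$\hat\rho_h(\mathbf r)=\int_{\Omega_h(\mathbf r)}\big(\rho(\mathbf r)-\rho(\mathbf r')\big)w_h(\mathbf r-\mathbf r')\,d^n\mathbf r'=\rho(\mathbf r)-\langle\rho_h(\mathbf r)\rangle.$$ *)

theory Defs
  imports "HOL-Analysis.Analysis"
begin

text \<open>\<open>C\<^sup>k\<close> and \<open>C\<^sup>\<infinity>\<close> regularity.  Both predicates are meant for open sets \<open>S\<close>, since the
  derivatives are taken in the full neighbourhood filter \<open>at x\<close>.\<close>

fun Ck_on :: "nat \<Rightarrow> 'a::real_normed_vector set \<Rightarrow> ('a \<Rightarrow> real) \<Rightarrow> bool" where
  "Ck_on 0 S f \<longleftrightarrow> continuous_on S f"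
| "Ck_on (Suc k) S f \<longleftrightarrow>
     (\<forall>x\<in>S. f differentiable (at x)) \<and> (\<forall>v. Ck_on k S (\<lambda>x. frechet_derivative f (at x) v))"

definition smooth_on :: "'a::real_normed_vector set \<Rightarrow> ('a \<Rightarrow> real) \<Rightarrow> bool" where
  "smooth_on S f \<longleftrightarrow> (\<forall>k. Ck_on k S f)"

text \<open>A smooth surface is an embedded hypersurface, given locally as a regular level set.  The empty
  set qualifies, so that the whole space is a fluid domain.\<close>

definition smooth_surface :: "'a::euclidean_space set \<Rightarrow> bool" where
  "smooth_surface \<Gamma> \<longleftrightarrow>
     (\<forall>p\<in>\<Gamma>. \<exists>U \<phi>. open U \<and> p \<in> U \<and> smooth_on U \<phi> \<and>
        (\<forall>x\<in>U. frechet_derivative \<phi> (at x) \<noteq> (\<lambda>_. 0)) \<and>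
        \<Gamma> \<inter> U = {x \<in> U. \<phi> x = 0})"

definition fluid_domain :: "'a::euclidean_space set \<Rightarrow> bool" where
  "fluid_domain \<Omega> \<longleftrightarrow> open \<Omega> \<and> smooth_surface (frontier \<Omega>)"

definition mass_density :: "'a::euclidean_space set \<Rightarrow> ('a \<Rightarrow> real) \<Rightarrow> bool" where
  "mass_density \<Omega> \<rho> \<longleftrightarrow> smooth_on \<Omega> \<rho> \<and> (\<forall>r\<in>\<Omega>. 0 < \<rho> r)"

definition test_space :: "real \<Rightarrow> 'a::euclidean_space \<Rightarrow> 'a set" where
  "test_space h r = {r'. norm (r - r') \<le> h}"

definition convolution_filter :: "real \<Rightarrow> ('a::euclidean_space \<Rightarrow> real) \<Rightarrow> bool" where
  "convolution_filter h w \<longleftrightarrow>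
     (\<forall>r. smooth_on UNIV (\<lambda>r'. w (r - r')) \<and>
          closure {r'. w (r - r') \<noteq> 0} = test_space h r \<and>
          (\<forall>r'. 0 \<le> w (r - r')) \<and>
          (LINT r':test_space h r|lborel. w (r - r')) = 1)"

text \<open>In the next two definitions \<open>w\<close> is the filter of length \<open>h\<close>.  They are only meaningful at points
  \<open>r\<close> with \<open>test_space h r \<subseteq> \<Omega>\<close>, as the values of \<open>\<rho>\<close> outside the fluid domain are arbitrary.\<close>

definition filtered_density ::
  "('a::euclidean_space \<Rightarrow> real) \<Rightarrow> ('a \<Rightarrow> real) \<Rightarrow> real \<Rightarrow> 'a \<Rightarrow> real" where
  "filtered_density w \<rho> h r = (LINT r':test_space h r|lborel. \<rho> r' * w (r - r'))"

definition density_fluctuation ::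
  "('a::euclidean_space \<Rightarrow> real) \<Rightarrow> ('a \<Rightarrow> real) \<Rightarrow> real \<Rightarrow> 'a \<Rightarrow> real" where
  "density_fluctuation w \<rho> h r = (LINT r':test_space h r|lborel. (\<rho> r - \<rho> r') * w (r - r'))"

end

theory Submission imports Defs
begin

text \<open>Since \<open>w\<close> has unit mass on the test space, the fluctuation equals the density minus the
  filtered density, so both convergence statements say the same thing; and the fluctuation at \<open>r\<close> is
  an average of the values \<open>\<rho> r - \<rho> r'\<close> over the ball of radius \<open>h\<close> around \<open>r\<close>, hence bounded by
  the modulus of continuity of \<open>\<rho>\<close> at \<open>h\<close>.  On a compact set \<open>K\<close> this tends to \<open>0\<close> because \<open>\<rho>\<close> is
  uniformly continuous on a compact neighbourhood of \<open>K\<close>.\<close>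

lemma test_space_eq_cball: "test_space h r = cball r h"
  by (auto simp: test_space_def dist_norm)

lemma mass_density_continuous_on: "mass_density \<Omega> \<rho> \<Longrightarrow> continuous_on \<Omega> \<rho>"
  unfolding mass_density_def smooth_on_def by (metis Ck_on.simps(1))

lemma convolution_filter_continuous_on:
  assumes "convolution_filter h w"
  shows "continuous_on S (\<lambda>r'. w (r - r'))"
proof -
  have "Ck_on 0 UNIV (\<lambda>r'. w (r - r'))"
    using assms unfolding convolution_filter_def smooth_on_def by blast
  then show ?thesis
    by (auto intro: continuous_on_subset)
qed

lemma set_integrable_continuous_filter:
  assumes "convolution_filter h w" "continuous_on (test_space h r) f"
  shows "set_integrable lborel (test_space h r) (\<lambda>r'. f r' * w (r - r'))"
  unfolding set_integrable_def
proof (rule borel_integrable_compact)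
  show "compact (test_space h r)"
    by (simp add: test_space_eq_cball)
  show "continuous_on (test_space h r) (\<lambda>r'. f r' * w (r - r'))"
    using assms convolution_filter_continuous_on by (intro continuous_on_mult)
qed

lemma density_fluctuation_eq_diff:
  assumes "convolution_filter h w" "continuous_on (test_space h r) \<rho>"
  shows "density_fluctuation w \<rho> h r = \<rho> r - filtered_density w \<rho> h r"
proof -
  have 1: "(LINT r':test_space h r|lborel. w (r - r')) = 1"
    using assms unfolding convolution_filter_def by blast
  have "density_fluctuation w \<rho> h r
      = (LINT r':test_space h r|lborel. \<rho> r * w (r - r') - \<rho> r' * w (r - r'))"
    by (simp add: density_fluctuation_def left_diff_distrib)
  also have "\<dots> = (LINT r':test_space h r|lborel. \<rho> r * w (r - r')) - filtered_density w \<rho> h r"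
    unfolding filtered_density_def
    by (intro set_integral_diff set_integrable_continuous_filter assms continuous_on_const)
  finally show ?thesis
    using 1 by simp
qed

lemma density_fluctuation_le:
  assumes w: "convolution_filter h w" and \<rho>: "continuous_on (test_space h r) \<rho>"
    and le: "\<And>r'. r' \<in> test_space h r \<Longrightarrow> \<bar>\<rho> r - \<rho> r'\<bar> \<le> e"
  shows "\<bar>density_fluctuation w \<rho> h r\<bar> \<le> e"
proof -
  have 1: "(LINT r':test_space h r|lborel. w (r - r')) = 1" and w0: "\<And>r'. 0 \<le> w (r - r')"
    using w unfolding convolution_filter_def by blast+
  have int: "set_integrable lborel (test_space h r) (\<lambda>r'. (\<rho> r - \<rho> r') * w (r - r'))"
    "set_integrable lborel (test_space h r) (\<lambda>r'. e * w (r - r'))"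
    using \<rho> by (auto intro!: set_integrable_continuous_filter w continuous_intros)
  have "\<bar>density_fluctuation w \<rho> h r\<bar>
      \<le> (LINT r':test_space h r|lborel. \<bar>(\<rho> r - \<rho> r') * w (r - r')\<bar>)"
    using set_integral_norm_bound[OF int(1)] by (simp add: density_fluctuation_def)
  also have "\<dots> \<le> (LINT r':test_space h r|lborel. e * w (r - r'))"
    \<comment> \<open>Nonnegativity of the filter is used here:
      \<open>\<bar>w (r - r')\<bar>\<close> is \<open>w (r - r')\<close>, so the bound
      \<open>e\<close> passes through the integral and unit mass returns it unchanged.\<close>
    by (intro set_integral_mono set_integrable_abs int)
       (auto simp: abs_mult w0 intro!: mult_right_mono le)
  also have "\<dots> = e"
    using 1 by simp
  finally show ?thesis .
qed

text \<open>The distance of \<open>f t x\<close> to \<open>l x\<close> is the norm of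
  \<open>l x - f t x\<close>. Eventual equality is all that is asked because the identity is only
  available for small positive filter lengths.\<close>

lemma uniform_limit_diff_zero_iff:
  fixes f :: "'b \<Rightarrow> 'a \<Rightarrow> 'c::real_normed_vector"
  assumes "\<forall>\<^sub>F t in F. \<forall>x\<in>S. g t x = l x - f t x"
  shows "uniform_limit S f l F \<longleftrightarrow> uniform_limit S g (\<lambda>_. 0) F"
proof -
  have "uniform_limit S g (\<lambda>_. 0) F \<longleftrightarrow> uniform_limit S (\<lambda>t x. l x - f t x) (\<lambda>_. 0) F"
    using assms by (intro uniform_limit_cong) auto
  also have "\<dots> \<longleftrightarrow> uniform_limit S f l F"
    by (simp add: uniform_limit_iff dist_norm norm_minus_commute)
  finally show ?thesis ..
qed

text \<open>Assumption \<open>S\<close> gives one threshold for all points of the set; below it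
  every integral sees only values of \<rho> inside \<Omega>, where \<rho> is continuous.\<close>

lemma uniform_limit_filtered_density_iff:
  assumes \<rho>: "continuous_on \<Omega> \<rho>"
    and w: "\<And>h. 0 < h \<Longrightarrow> convolution_filter h (w h)"
    and S: "\<forall>\<^sub>F h in at_right 0. \<forall>r\<in>S. test_space h r \<subseteq> \<Omega>"
  shows "uniform_limit S (\<lambda>h. filtered_density (w h) \<rho> h) \<rho> (at_right 0) \<longleftrightarrow>
    uniform_limit S (\<lambda>h. density_fluctuation (w h) \<rho> h) (\<lambda>_. 0) (at_right 0)"
proof (rule uniform_limit_diff_zero_iff)
  show "\<forall>\<^sub>F h in at_right 0. \<forall>r\<in>S.
      density_fluctuation (w h) \<rho> h r = \<rho> r - filtered_density (w h) \<rho> h r"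
    using S eventually_at_right_less[of 0]
    by eventually_elim (auto intro!: density_fluctuation_eq_diff w continuous_on_subset[OF \<rho>])
qed

text \<open>The set \<open>L\<close> depends on neither \<open>h\<close> nor \<open>r\<close>, so a
  single modulus of continuity on \<open>L\<close> will serve all centres and all small
  lengths.\<close>

lemma compact_neighbourhood_test_space:
  fixes K \<Omega> :: "'a::euclidean_space set"
  assumes "compact K" "open \<Omega>" "K \<subseteq> \<Omega>"
  obtains e L where "0 < e" "compact L" "L \<subseteq> \<Omega>" "\<And>h r. h \<le> e \<Longrightarrow> r \<in> K \<Longrightarrow> test_space h r \<subseteq> L"
proof -
  obtain e where e: "0 < e" "(\<Union>x\<in>K. cball x e) \<subseteq> \<Omega>"
    using compact_subset_open_imp_cball_epsilon_subset[OF assms] by blast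
  \<comment> \<open>The neighbourhood is the Minkowski sum of \<open>K\<close> and
    \<open>cball 0 e\<close>, hence compact; the witness is the displacement from the
    centre.\<close>
  have "(\<Union>x\<in>K. cball x e) = (\<Union>x\<in>K. \<Union>y\<in>cball 0 e. {x + y})"
    by (force simp: dist_norm norm_minus_commute intro: rev_bexI[where x = "_ - _"])
  then have "compact (\<Union>x\<in>K. cball x e)"
    using compact_sums'[OF assms(1) compact_cball] by metis
  moreover have "test_space h r \<subseteq> (\<Union>x\<in>K. cball x e)" if "h \<le> e" "r \<in> K" for h r
    using that by (force simp: test_space_eq_cball)
  ultimately show ?thesis
    using e that by blast
qed

lemma uniform_limit_density_fluctuation:
  assumes K: "compact K" "K \<subseteq> \<Omega>" "open \<Omega>" and \<rho>: "continuous_on \<Omega> \<rho>"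
    and w: "\<And>h. 0 < h \<Longrightarrow> convolution_filter h (w h)"
  shows "uniform_limit K (\<lambda>h. density_fluctuation (w h) \<rho> h) (\<lambda>_. 0) (at_right 0)"
  unfolding uniform_limit_iff
proof (intro allI impI)
  fix \<epsilon> :: real
  assume "0 < \<epsilon>"
  obtain \<delta> L where \<delta>: "0 < \<delta>" and L: "compact L" "L \<subseteq> \<Omega>"
    and ball: "\<And>h r. h \<le> \<delta> \<Longrightarrow> r \<in> K \<Longrightarrow> test_space h r \<subseteq> L"
    using compact_neighbourhood_test_space K by metis
  have \<rho>L: "continuous_on L \<rho>"
    using \<rho> L(2) by (rule continuous_on_subset)
  \<comment> \<open>Half of \<epsilon> leaves room for the averaged bound, which is not strict,
    while the uniform limit needs a strict one.\<close>
  then obtain d where d: "0 < d"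
    and uc: "\<And>x y. x \<in> L \<Longrightarrow> y \<in> L \<Longrightarrow> dist y x < d \<Longrightarrow> dist (\<rho> y) (\<rho> x) < \<epsilon> / 2"
    using compact_uniformly_continuous[OF _ L(1)] \<open>0 < \<epsilon>\<close>
    unfolding uniformly_continuous_on_def by (metis half_gt_zero)
  \<comment> \<open>Below \<delta> the balls stay in \<open>L\<close>; below \<open>d\<close> every
    point of a ball is close enough to its centre for \<open>uc\<close>.\<close>
  have "\<forall>\<^sub>F h in at_right 0. h \<in> {0<..<min \<delta> d}"
    using \<delta> d by (intro eventually_at_right_real) simp
  then show "\<forall>\<^sub>F h in at_right 0. \<forall>r\<in>K. dist (density_fluctuation (w h) \<rho> h r) 0 < \<epsilon>"
  proof eventually_elim
    case (elim h)
    show ?case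
    proof
      fix r
      assume "r \<in> K"
      then have sub: "test_space h r \<subseteq> L"
        using ball elim by simp
      have r: "r \<in> test_space h r"
        using elim by (simp add: test_space_eq_cball)
      have "\<bar>density_fluctuation (w h) \<rho> h r\<bar> \<le> \<epsilon> / 2"
      proof (rule density_fluctuation_le)
        show "convolution_filter h (w h)"
          using elim w by simp
        show "continuous_on (test_space h r) \<rho>"
          using \<rho>L sub by (rule continuous_on_subset)
        fix r'
        assume r': "r' \<in> test_space h r"
        then have "dist r r' < d"
          using elim by (simp add: test_space_eq_cball)
        then show "\<bar>\<rho> r - \<rho> r'\<bar> \<le> \<epsilon> / 2"
          using uc[of r' r] r r' sub by (force simp: dist_real_def)
      qed
      then show "dist (density_fluctuation (w h) \<rho> h r) 0 < \<epsilon>"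
        using \<open>0 < \<epsilon>\<close> by simp
    qed
  qed
qed

lemma eventually_test_space_subset:
  assumes "compact K" "open \<Omega>" "K \<subseteq> \<Omega>"
  shows "\<forall>\<^sub>F h in at_right 0. \<forall>r\<in>K. test_space h r \<subseteq> \<Omega>"
proof -
  obtain e L where "0 < e" "L \<subseteq> \<Omega>" "\<And>h r. h \<le> e \<Longrightarrow> r \<in> K \<Longrightarrow> test_space h r \<subseteq> L"
    using compact_neighbourhood_test_space assms by metis
  then show ?thesis
    unfolding eventually_at_right_field by (meson less_imp_le order_trans)
qed

text \<open>Convergence is asserted on compact subsets because \<rho> may fail to be uniformly
  continuous on all of \<Omega>. The equivalence is pointwise algebra and so covers any
  \<open>S\<close> whose test spaces eventually lie in \<Omega>.\<close>

theorem theorem5p2: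
  fixes \<Omega> :: "(real ^ 'n) set"
    and \<rho> :: "real ^ 'n \<Rightarrow> real"
    and w :: "real \<Rightarrow> real ^ 'n \<Rightarrow> real"
  assumes "fluid_domain \<Omega>"
    and "mass_density \<Omega> \<rho>"
    and "\<And>h. 0 < h \<Longrightarrow> convolution_filter h (w h)"
  shows "(\<forall>S\<subseteq>\<Omega>. (\<forall>\<^sub>F h in at_right 0. \<forall>r\<in>S. test_space h r \<subseteq> \<Omega>) \<longrightarrow>
            (uniform_limit S (\<lambda>h. filtered_density (w h) \<rho> h) \<rho> (at_right 0) \<longleftrightarrow>
             uniform_limit S (\<lambda>h. density_fluctuation (w h) \<rho> h) (\<lambda>_. 0) (at_right 0))) \<and>
         (\<forall>K\<subseteq>\<Omega>. compact K \<longrightarrow>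
            (\<forall>\<^sub>F h in at_right 0. \<forall>r\<in>K. test_space h r \<subseteq> \<Omega>) \<and>
            uniform_limit K (\<lambda>h. filtered_density (w h) \<rho> h) \<rho> (at_right 0) \<and>
            uniform_limit K (\<lambda>h. density_fluctuation (w h) \<rho> h) (\<lambda>_. 0) (at_right 0))"
proof -
  have \<Omega>: "open \<Omega>"
    using assms(1) by (simp add: fluid_domain_def)
  have \<rho>: "continuous_on \<Omega> \<rho>"
    using assms(2) by (rule mass_density_continuous_on)
  note iff = uniform_limit_filtered_density_iff[OF \<rho> assms(3)]
  show ?thesis
  proof (intro conjI allI impI)
    fix K
    assume K: "K \<subseteq> \<Omega>" "compact K"
    show sub: "\<forall>\<^sub>F h in at_right 0. \<forall>r\<in>K. test_space h r \<subseteq> \<Omega>"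
      using K \<Omega> by (intro eventually_test_space_subset)
    show lim: "uniform_limit K (\<lambda>h. density_fluctuation (w h) \<rho> h) (\<lambda>_. 0) (at_right 0)"
      using K \<Omega> \<rho> assms(3) by (intro uniform_limit_density_fluctuation)
    \<comment> \<open>The estimate was made for the fluctuation; the equivalence on \<open>K\<close>
      carries it over to the filtered density.\<close>
    show "uniform_limit K (\<lambda>h. filtered_density (w h) \<rho> h) \<rho> (at_right 0)"
      using iff[OF _ sub] lim by simp
  qed (rule iff)
qed

end
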